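(* Let $(M,J,g)$ be an almost Norden manifold with associated metric $\widetilde g(X,Y)=g(X,JY)$, and let $\nabla$ and $\nabla^\ast$ be linear connections on $M$. Then each two of the following conditions imply the third one: (i) $\nabla$ and $\nabla^\ast$ are conjugate relative to $g$; (ii) $\nabla$ and $\nabla^\ast$ are conjugate relative to $\widetilde g$; (iii) $\nabla J=0$ (equivalently, $\nabla^\ast J=0$).
   Context: An almost Norden manifold $(M,J,g)$ is a differentiable $2n$-dimensional manifold $M$ with an almost complex structure $J$ ($J^2=-\mathrm{id}$) and a pseudo-Riemannian metric $g$ such that $g(JX,JY)=-g(X,Y)$. Then $\widetilde g(X,Y)=g(X,JY)$ is symmetric and is also a pseudo-Riemannian metric with $\widetilde g(JX,JY)=-\widetilde g(X,Y)$. Linear connections $\nabla,\nabla^\ast$ are conjugate relative to a pseudo-Riemannian metric $h$ if $X h(Y,Z)=h(\nabla_XY,Z)+h(Y,\nabla^\ast_XZ)$ for all vector fields $X,Y,Z$. In (iii), the parenthetical means that the condition may be read with either $\nabla$ or $\nabla^\ast$; whenever $\nabla,\nabla^\ast$ are conjugate relative to $g$ or to $\widetilde g$, $\nabla J=0$ holds if and only if $\nabla^\ast J=0$. *)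

theory Defs
  imports "HOL-Analysis.Analysis" "HOL-Library.Function_Algebras"
begin

text \<open>
  Scalar functions and vector fields are added, negated and (for functions) multiplied
  pointwise, by the instances of \<^theory>\<open>HOL-Library.Function_Algebras\<close>.
\<close>

section \<open>Smooth manifolds\<close>

text \<open>Only used for open \<open>S\<close>, where \<open>Ck_on k S f\<close> says that \<open>f\<close> is of class \<open>C\<^sup>k\<close> on \<open>S\<close>.\<close>

primrec Ck_on :: "nat \<Rightarrow> 'e::euclidean_space set \<Rightarrow> ('e \<Rightarrow> 'f::real_normed_vector) \<Rightarrow> bool" where
  "Ck_on 0 S f \<longleftrightarrow> continuous_on S f"
| "Ck_on (Suc k) S f \<longleftrightarrow>
     (\<forall>x\<in>S. f differentiable (at x)) \<and> (\<forall>v. Ck_on k S (\<lambda>x. frechet_derivative f (at x) v))"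

definition smooth_on :: "'e::euclidean_space set \<Rightarrow> ('e \<Rightarrow> 'f::real_normed_vector) \<Rightarrow> bool" where
  "smooth_on S f \<longleftrightarrow> (\<forall>k. Ck_on k S f)"

text \<open>
  The manifold is the whole type \<open>'m\<close>. A chart is a pair \<open>(U, \<phi>)\<close>; the values of \<open>\<phi>\<close> outside
  \<open>U\<close> are irrelevant. The model space \<open>'e\<close> is a Euclidean space, so the dimension is \<open>DIM('e)\<close>.
\<close>

type_synonym ('m, 'e) chart = "'m set \<times> ('m \<Rightarrow> 'e)"

definition is_chart :: "('m::topological_space, 'e::euclidean_space) chart \<Rightarrow> bool" where
  "is_chart = (\<lambda>(U, \<phi>). open U \<and> open (\<phi> ` U) \<and> homeomorphism U (\<phi> ` U) \<phi> (inv_into U \<phi>))"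

definition smooth_manifold ::
    "('m::{t2_space, second_countable_topology}, 'e::euclidean_space) chart set \<Rightarrow> bool" where
  "smooth_manifold A \<longleftrightarrow>
     (\<forall>c\<in>A. is_chart c) \<and>
     (\<Union>(U, \<phi>)\<in>A. U) = UNIV \<and>
     (\<forall>(U, \<phi>)\<in>A. \<forall>(V, \<psi>)\<in>A. smooth_on (\<phi> ` (U \<inter> V)) (\<psi> \<circ> inv_into U \<phi>))"

definition smooth_functions ::
    "('m::topological_space, 'e::euclidean_space) chart set \<Rightarrow> ('m \<Rightarrow> real) set" where
  "smooth_functions A = {f. \<forall>(U, \<phi>)\<in>A. smooth_on (\<phi> ` U) (f \<circ> inv_into U \<phi>)}"

section \<open>Vector fields\<close>

text \<open>
  A vector field is a derivation of the algebra of smooth functions. It is extended by \<open>0\<close> to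
  nonsmooth functions, so that equality of vector fields is equality of the HOL functions.
  The tangent vector of \<open>X\<close> at \<open>p\<close> is the functional \<open>f \<mapsto> X f p\<close>.
\<close>

type_synonym 'm vfield = "('m \<Rightarrow> real) \<Rightarrow> ('m \<Rightarrow> real)"

definition vector_fields ::
    "('m::topological_space, 'e::euclidean_space) chart set \<Rightarrow> 'm vfield set" where
  "vector_fields A = {X.
     (\<forall>f\<in>smooth_functions A. X f \<in> smooth_functions A) \<and>
     (\<forall>f. f \<notin> smooth_functions A \<longrightarrow> X f = 0) \<and>
     (\<forall>f\<in>smooth_functions A. \<forall>h\<in>smooth_functions A. X (f + h) = X f + X h) \<and>
     (\<forall>c. \<forall>f\<in>smooth_functions A. X (\<lambda>p. c * f p) = (\<lambda>p. c * X f p)) \<and>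
     (\<forall>f\<in>smooth_functions A. \<forall>h\<in>smooth_functions A. X (f * h) = X f * h + f * X h)}"

definition vf_scale :: "('m \<Rightarrow> real) \<Rightarrow> 'm vfield \<Rightarrow> 'm vfield" (infixr "\<cdot>\<^sub>v" 75) where
  "f \<cdot>\<^sub>v X = (\<lambda>h. f * X h)"

section \<open>Metrics, almost complex structures, connections\<close>

text \<open>
  Tensor fields are multilinear maps over the smooth functions. Such a \<open>g\<close> induces
  \<open>g\<^sub>p(X\<^sub>p, Y\<^sub>p) = g X Y p\<close> on the tangent space at \<open>p\<close>, and the last clause below is nondegeneracy
  of \<open>g\<^sub>p\<close> for every \<open>p\<close>. No signature condition is imposed: a Norden metric always has
  neutral signature.
\<close>

definition pseudo_riemannian_metric ::
    "('m::topological_space, 'e::euclidean_space) chart set \<Rightarrow>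
     ('m vfield \<Rightarrow> 'm vfield \<Rightarrow> 'm \<Rightarrow> real) \<Rightarrow> bool" where
  "pseudo_riemannian_metric A g \<longleftrightarrow>
     (\<forall>X\<in>vector_fields A. \<forall>Y\<in>vector_fields A. g X Y \<in> smooth_functions A) \<and>
     (\<forall>X\<in>vector_fields A. \<forall>Y\<in>vector_fields A. g X Y = g Y X) \<and>
     (\<forall>X\<in>vector_fields A. \<forall>Y\<in>vector_fields A. \<forall>Z\<in>vector_fields A.
        g (X + Y) Z = g X Z + g Y Z) \<and>
     (\<forall>f\<in>smooth_functions A. \<forall>X\<in>vector_fields A. \<forall>Y\<in>vector_fields A.
        g (f \<cdot>\<^sub>v X) Y = f * g X Y) \<and>
     (\<forall>p. \<forall>X\<in>vector_fields A. (\<forall>Y\<in>vector_fields A. g X Y p = 0) \<longrightarrow>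
        (\<forall>f\<in>smooth_functions A. X f p = 0))"

definition almost_complex_structure ::
    "('m::topological_space, 'e::euclidean_space) chart set \<Rightarrow> ('m vfield \<Rightarrow> 'm vfield) \<Rightarrow> bool" where
  "almost_complex_structure A J \<longleftrightarrow>
     (\<forall>X\<in>vector_fields A. J X \<in> vector_fields A) \<and>
     (\<forall>X\<in>vector_fields A. \<forall>Y\<in>vector_fields A. J (X + Y) = J X + J Y) \<and>
     (\<forall>f\<in>smooth_functions A. \<forall>X\<in>vector_fields A. J (f \<cdot>\<^sub>v X) = f \<cdot>\<^sub>v J X) \<and>
     (\<forall>X\<in>vector_fields A. J (J X) = - X)"

definition almost_norden_manifold ::
    "('m::{t2_space, second_countable_topology}, 'e::euclidean_space) chart set \<Rightarrow>
     ('m vfield \<Rightarrow> 'm vfield) \<Rightarrow> ('m vfield \<Rightarrow> 'm vfield \<Rightarrow> 'm \<Rightarrow> real) \<Rightarrow> bool" where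
  "almost_norden_manifold A J g \<longleftrightarrow>
     smooth_manifold A \<and> even DIM('e) \<and>
     almost_complex_structure A J \<and> pseudo_riemannian_metric A g \<and>
     (\<forall>X\<in>vector_fields A. \<forall>Y\<in>vector_fields A. g (J X) (J Y) = - g X Y)"

definition associated_metric ::
    "('m vfield \<Rightarrow> 'm vfield) \<Rightarrow> ('m vfield \<Rightarrow> 'm vfield \<Rightarrow> 'm \<Rightarrow> real) \<Rightarrow>
     'm vfield \<Rightarrow> 'm vfield \<Rightarrow> 'm \<Rightarrow> real" where
  "associated_metric J g X Y = g X (J Y)"

text \<open>\<open>N X Y\<close> stands for \<open>\<nabla>\<^sub>X Y\<close>.\<close>

definition linear_connection ::
    "('m::topological_space, 'e::euclidean_space) chart set \<Rightarrow>
     ('m vfield \<Rightarrow> 'm vfield \<Rightarrow> 'm vfield) \<Rightarrow> bool" where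
  "linear_connection A N \<longleftrightarrow>
     (\<forall>X\<in>vector_fields A. \<forall>Y\<in>vector_fields A. N X Y \<in> vector_fields A) \<and>
     (\<forall>X\<in>vector_fields A. \<forall>Y\<in>vector_fields A. \<forall>Z\<in>vector_fields A.
        N (X + Y) Z = N X Z + N Y Z) \<and>
     (\<forall>f\<in>smooth_functions A. \<forall>X\<in>vector_fields A. \<forall>Y\<in>vector_fields A.
        N (f \<cdot>\<^sub>v X) Y = f \<cdot>\<^sub>v N X Y) \<and>
     (\<forall>X\<in>vector_fields A. \<forall>Y\<in>vector_fields A. \<forall>Z\<in>vector_fields A.
        N X (Y + Z) = N X Y + N X Z) \<and>
     (\<forall>c. \<forall>X\<in>vector_fields A. \<forall>Y\<in>vector_fields A.
        N X ((\<lambda>_. c) \<cdot>\<^sub>v Y) = (\<lambda>_. c) \<cdot>\<^sub>v N X Y) \<and>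
     (\<forall>f\<in>smooth_functions A. \<forall>X\<in>vector_fields A. \<forall>Y\<in>vector_fields A.
        N X (f \<cdot>\<^sub>v Y) = X f \<cdot>\<^sub>v Y + f \<cdot>\<^sub>v N X Y)"

definition conjugate_connections ::
    "('m::topological_space, 'e::euclidean_space) chart set \<Rightarrow>
     ('m vfield \<Rightarrow> 'm vfield \<Rightarrow> 'm \<Rightarrow> real) \<Rightarrow>
     ('m vfield \<Rightarrow> 'm vfield \<Rightarrow> 'm vfield) \<Rightarrow> ('m vfield \<Rightarrow> 'm vfield \<Rightarrow> 'm vfield) \<Rightarrow> bool" where
  "conjugate_connections A h N N' \<longleftrightarrow>
     (\<forall>X\<in>vector_fields A. \<forall>Y\<in>vector_fields A. \<forall>Z\<in>vector_fields A.
        X (h Y Z) = h (N X Y) Z + h Y (N' X Z))"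

definition covariant_derivative_endo ::
    "('m vfield \<Rightarrow> 'm vfield \<Rightarrow> 'm vfield) \<Rightarrow> ('m vfield \<Rightarrow> 'm vfield) \<Rightarrow>
     'm vfield \<Rightarrow> 'm vfield \<Rightarrow> 'm vfield" where
  "covariant_derivative_endo N J X Y = N X (J Y) - J (N X Y)"

definition parallel_endo ::
    "('m::topological_space, 'e::euclidean_space) chart set \<Rightarrow>
     ('m vfield \<Rightarrow> 'm vfield \<Rightarrow> 'm vfield) \<Rightarrow> ('m vfield \<Rightarrow> 'm vfield) \<Rightarrow> bool" where
  "parallel_endo A N J \<longleftrightarrow>
     (\<forall>X\<in>vector_fields A. \<forall>Y\<in>vector_fields A. covariant_derivative_endo N J X Y = 0)"

end

theory Submission
  imports Defs
begin

text \<open>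
  If \<open>\<nabla>\<close> and \<open>\<nabla>\<^sup>\<star>\<close> are conjugate relative to \<open>g\<close>, then subtracting the conjugacy identity for
  \<open>g(Y, JZ)\<close> from the one for the associated metric at \<open>(Y, Z)\<close> leaves \<open>g(Y, (\<nabla>\<^sup>\<star>\<^sub>X J) Z) = 0\<close>,
  so by nondegeneracy conjugacy relative to the associated metric is equivalent to \<open>\<nabla>\<^sup>\<star> J = 0\<close>.
  Conjugacy is symmetric in the two connections, which gives the same for \<open>\<nabla>\<close>. The associated
  metric is again a Norden metric, and its own associated metric is \<open>-g\<close>; applying the
  equivalence to it settles the case where conjugacy relative to the associated metric is given.
\<close>

section \<open>Smooth functions and vector fields: closure under differences\<close>

lemma Ck_on_cong:
  assumes "open S" "\<And>x. x \<in> S \<Longrightarrow> f x = g x" "Ck_on k S f"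
  shows "Ck_on k S g"
  using assms(2,3)
proof (induction k arbitrary: f g)
  case 0
  then show ?case using continuous_on_cong[of S S f g] by simp
next
  case (Suc k)
  \<comment> \<open>Openness of \<open>S\<close> makes \<open>f\<close> and \<open>g\<close> agree
    near \<open>x\<close>, so they share a derivative there, and the hypothesis of the induction
    passes to the derivatives.\<close>
  have D: "(g has_derivative frechet_derivative f (at x)) (at x)" if "x \<in> S" for x
  proof -
    have "(f has_derivative frechet_derivative f (at x)) (at x)"
      using Suc.prems(2) that by (simp add: frechet_derivative_works)
    then show ?thesis
      using assms(1) that Suc.prems(1) by (rule has_derivative_transform_within_open)
  qed
  have eq: "frechet_derivative f (at x) v = frechet_derivative g (at x) v" if "x \<in> S" for x v
    using frechet_derivative_at[OF D[OF that]] by simp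
  have "Ck_on k S (\<lambda>x. frechet_derivative g (at x) v)" for v
    using Suc.prems(2) Suc.IH[OF eq] by simp
  moreover have "g differentiable (at x)" if "x \<in> S" for x
    using D[OF that] by (rule differentiableI)
  ultimately show ?case by simp
qed

text \<open>\<open>frechet_derivative\<close> obeys the difference rule only where \<open>f\<close>
  and \<open>g\<close> are differentiable, here on \<open>S\<close>; \<open>Ck_on_cong\<close>
  absorbs whatever happens elsewhere.\<close>

lemma Ck_on_diff:
  assumes "open S" "Ck_on k S f" "Ck_on k S g"
  shows "Ck_on k S (\<lambda>x. f x - g x)"
  using assms(2,3)
proof (induction k arbitrary: f g)
  case 0
  then show ?case by (simp add: continuous_on_diff)
next
  case (Suc k)
  have D: "((\<lambda>x. f x - g x) has_derivative
      (\<lambda>v. frechet_derivative f (at x) v - frechet_derivative g (at x) v)) (at x)"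
    if "x \<in> S" for x
    using Suc.prems that by (intro has_derivative_diff) (simp_all add: frechet_derivative_works)
  have eq: "frechet_derivative f (at x) v - frechet_derivative g (at x) v
      = frechet_derivative (\<lambda>x. f x - g x) (at x) v" if "x \<in> S" for x v
    using frechet_derivative_at[OF D[OF that]] by metis
  have "Ck_on k S (\<lambda>x. frechet_derivative f (at x) v - frechet_derivative g (at x) v)" for v
    using Suc by simp
  then have "Ck_on k S (\<lambda>x. frechet_derivative (\<lambda>x. f x - g x) (at x) v)" for v
    \<comment> \<open>Resolution makes the point and the direction in \<open>eq\<close> functions of
      the bound point: the identity and the constant \<open>v\<close>.\<close>
    using Ck_on_cong[OF assms(1) eq, of "\<lambda>x. x" k "\<lambda>_. v"] by simp
  moreover have "(\<lambda>x. f x - g x) differentiable (at x)" if "x \<in> S" for x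
    using D[OF that] by (rule differentiableI)
  ultimately show ?case by simp
qed

lemma smooth_functions_diff:
  assumes "smooth_manifold A" "f \<in> smooth_functions A" "h \<in> smooth_functions A"
  shows "f - h \<in> smooth_functions A"
proof -
  have "smooth_on (\<phi> ` U) ((f - h) \<circ> inv_into U \<phi>)" if c: "(U, \<phi>) \<in> A" for U \<phi>
  proof -
    have "open (\<phi> ` U)"
      using assms(1) c by (fastforce simp: smooth_manifold_def is_chart_def)
    moreover have "smooth_on (\<phi> ` U) (f \<circ> inv_into U \<phi>)" "smooth_on (\<phi> ` U) (h \<circ> inv_into U \<phi>)"
      using assms(2,3) c by (auto simp: smooth_functions_def)
    ultimately show ?thesis
      using Ck_on_diff[of "\<phi> ` U" _ "f \<circ> inv_into U \<phi>" "h \<circ> inv_into U \<phi>"]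
      by (simp add: smooth_on_def comp_def)
  qed
  then show ?thesis by (auto simp: smooth_functions_def)
qed

text \<open>Makes the covariant derivative of \<open>J\<close>, a difference of two vector fields, a
  vector field to which nondegeneracy applies.\<close>

lemma vector_fields_diff:
  assumes "smooth_manifold A" "X \<in> vector_fields A" "Y \<in> vector_fields A"
  shows "X - Y \<in> vector_fields A"
proof -
  have "(X - Y) (\<lambda>p. c * f p) = (\<lambda>p. c * (X - Y) f p)" if "f \<in> smooth_functions A" for c f
  proof -
    have "X (\<lambda>p. c * f p) = (\<lambda>p. c * X f p)" "Y (\<lambda>p. c * f p) = (\<lambda>p. c * Y f p)"
      using assms(2,3) that by (auto simp: vector_fields_def)
    then show ?thesis by (auto simp: right_diff_distrib)
  qed
  then show ?thesis
    using assms smooth_functions_diff[OF assms(1)]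
    by (auto simp: vector_fields_def algebra_simps)
qed

lemma vector_field_uminus:
  assumes "X \<in> vector_fields A" "f \<in> smooth_functions A"
  shows "X (- f) = - X f"
proof -
  have "X (\<lambda>p. - 1 * f p) = (\<lambda>p. - 1 * X f p)"
    using assms unfolding vector_fields_def by blast
  then show ?thesis by (simp add: fun_Compl_def)
qed

section \<open>Algebra of a pseudo-Riemannian metric and its conjugate connections\<close>

locale metric =
  fixes A :: "('m::{t2_space, second_countable_topology}, 'e::euclidean_space) chart set"
    and g :: "'m vfield \<Rightarrow> 'm vfield \<Rightarrow> 'm \<Rightarrow> real"
  assumes manifold: "smooth_manifold A"
    and metric: "pseudo_riemannian_metric A g"
begin

lemma sym: "X \<in> vector_fields A \<Longrightarrow> Y \<in> vector_fields A \<Longrightarrow> g X Y = g Y X"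
  using metric by (simp add: pseudo_riemannian_metric_def)

lemma smooth: "X \<in> vector_fields A \<Longrightarrow> Y \<in> vector_fields A \<Longrightarrow> g X Y \<in> smooth_functions A"
  using metric by (simp add: pseudo_riemannian_metric_def)

lemma diff_closed: "X \<in> vector_fields A \<Longrightarrow> Y \<in> vector_fields A \<Longrightarrow> X - Y \<in> vector_fields A"
  using vector_fields_diff[OF manifold] .

lemma zero_closed: "X \<in> vector_fields A \<Longrightarrow> 0 \<in> vector_fields A"
  using diff_closed[of X X] by simp

lemma diff_left:
  assumes "X \<in> vector_fields A" "Y \<in> vector_fields A" "Z \<in> vector_fields A"
  shows "g (X - Y) Z = g X Z - g Y Z"
proof -
  have "g (X - Y + Y) Z = g (X - Y) Z + g Y Z"
    using metric assms diff_closed unfolding pseudo_riemannian_metric_def by blast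
  then show ?thesis by (simp add: algebra_simps)
qed

lemma diff_right:
  assumes "X \<in> vector_fields A" "Y \<in> vector_fields A" "Z \<in> vector_fields A"
  shows "g Z (X - Y) = g Z X - g Z Y"
  using diff_left[OF assms] assms by (simp add: sym[of Z] diff_closed)

lemma zero_right: "X \<in> vector_fields A \<Longrightarrow> g X 0 = 0"
  using diff_right[of X X X] by simp

lemma uminus_right:
  assumes "X \<in> vector_fields A" "Y \<in> vector_fields A"
  shows "g X (- Y) = - g X Y"
  using diff_right[of 0 Y X] assms zero_closed zero_right by simp

text \<open>The pointwise axiom annihilates \<open>W\<close> on smooth functions only; on all others
  \<open>W\<close> is zero by the convention for vector fields.\<close>

lemma nondegenerate:
  assumes "W \<in> vector_fields A" "\<And>Z. Z \<in> vector_fields A \<Longrightarrow> g Z W = 0"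
  shows "W = 0"
proof (rule ext)
  fix f
  have "W f p = 0" if "f \<in> smooth_functions A" for p
    using metric assms that by (simp add: pseudo_riemannian_metric_def)
  moreover have "W f = 0" if "f \<notin> smooth_functions A"
    using assms(1) that by (simp add: vector_fields_def)
  ultimately show "W f = 0 f" by (cases "f \<in> smooth_functions A") auto
qed

text \<open>Exchange \<open>Y\<close> and \<open>Z\<close> in the conjugacy identity and use the
  symmetry of \<open>g\<close> in each term.\<close>

lemma conjugate_swap:
  assumes "linear_connection A N" "linear_connection A N'" "conjugate_connections A g N N'"
  shows "conjugate_connections A g N' N"
  unfolding conjugate_connections_def
proof (intro ballI)
  fix X Y Z assume XYZ: "X \<in> vector_fields A" "Y \<in> vector_fields A" "Z \<in> vector_fields A"
  then have "N X Z \<in> vector_fields A" "N' X Y \<in> vector_fields A"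
    using assms(1,2) by (simp_all add: linear_connection_def)
  moreover have "X (g Z Y) = g (N X Z) Y + g Z (N' X Y)"
    using assms(3) XYZ unfolding conjugate_connections_def by blast
  ultimately show "X (g Y Z) = g (N' X Y) Z + g Y (N X Z)"
    using XYZ by (simp add: sym add.commute)
qed

end

section \<open>The associated metric of an almost Norden manifold\<close>

locale almost_norden =
  fixes A :: "('m::{t2_space, second_countable_topology}, 'e::euclidean_space) chart set"
    and J :: "'m vfield \<Rightarrow> 'm vfield"
    and g :: "'m vfield \<Rightarrow> 'm vfield \<Rightarrow> 'm \<Rightarrow> real"
  assumes norden: "almost_norden_manifold A J g"

sublocale almost_norden \<subseteq> metric
  using norden by unfold_locales (simp_all add: almost_norden_manifold_def)

context almost_norden
begin

lemma J_closed: "X \<in> vector_fields A \<Longrightarrow> J X \<in> vector_fields A"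
  using norden by (simp add: almost_norden_manifold_def almost_complex_structure_def)

lemma J_J: "X \<in> vector_fields A \<Longrightarrow> J (J X) = - X"
  using norden by (simp add: almost_norden_manifold_def almost_complex_structure_def)

lemma J_anti_isometry: "X \<in> vector_fields A \<Longrightarrow> Y \<in> vector_fields A \<Longrightarrow> g (J X) (J Y) = - g X Y"
  using norden by (simp add: almost_norden_manifold_def)

text \<open>Put \<open>J Y\<close> for \<open>Y\<close> in the anti-isometry: the sign from
  \<open>J (J Y) = - Y\<close> cancels the other one. This yields the symmetry of the associated
  metric.\<close>

lemma J_self_adjoint:
  assumes "X \<in> vector_fields A" "Y \<in> vector_fields A"
  shows "g X (J Y) = g (J X) Y"
  using J_anti_isometry[of X "J Y"] assms by (simp add: J_closed J_J uminus_right)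

lemma associated_associated:
  assumes "X \<in> vector_fields A" "Y \<in> vector_fields A"
  shows "associated_metric J (associated_metric J g) X Y = - g X Y"
  using assms by (simp only: associated_metric_def J_J uminus_right J_closed)

text \<open>\<open>J\<close> is invertible up to sign, so testing against all \<open>J Y\<close> is
  as strong as testing against all \<open>Y\<close>.\<close>

lemma associated_metric_nondegenerate:
  assumes X: "X \<in> vector_fields A" and *: "\<And>Y. Y \<in> vector_fields A \<Longrightarrow> g X (J Y) p = 0"
    and f: "f \<in> smooth_functions A"
  shows "X f p = 0"
proof -
  have "g X Y p = 0" if "Y \<in> vector_fields A" for Y
    using *[of "J Y"] X that by (simp add: J_closed J_J uminus_right)
  then show ?thesis
    using metric X f unfolding pseudo_riemannian_metric_def by blast
qed

lemma associated_metric_pseudo_riemannian: "pseudo_riemannian_metric A (associated_metric J g)"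
  unfolding pseudo_riemannian_metric_def associated_metric_def
proof (intro conjI ballI allI impI)
  fix X Y assume XY: "X \<in> vector_fields A" "Y \<in> vector_fields A"
  show "g X (J Y) \<in> smooth_functions A"
    using XY by (intro smooth J_closed)
  show "g X (J Y) = g Y (J X)"
    unfolding J_self_adjoint[OF XY] using XY by (intro sym J_closed)
  show "g (X + Z) (J Y) = g X (J Y) + g Z (J Y)" if "Z \<in> vector_fields A" for Z
    using metric J_closed XY that unfolding pseudo_riemannian_metric_def by blast
  show "g (f \<cdot>\<^sub>v X) (J Y) = f * g X (J Y)" if "f \<in> smooth_functions A" for f
    using metric J_closed XY that unfolding pseudo_riemannian_metric_def by blast
next
  fix p X f
  assume "X \<in> vector_fields A" "\<forall>Y\<in>vector_fields A. g X (J Y) p = 0" "f \<in> smooth_functions A"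
  then show "X f p = 0"
    using associated_metric_nondegenerate by blast
qed

text \<open>Allows every result of this locale to be reused with the associated metric in the place
  of \<open>g\<close>.\<close>

lemma associated_norden: "almost_norden_manifold A J (associated_metric J g)"
  using norden associated_metric_pseudo_riemannian
  by (simp add: almost_norden_manifold_def associated_metric_def J_closed fun_Compl_def)

lemma conjugate_associated_iff_parallel':
  assumes N: "linear_connection A N" and N': "linear_connection A N'"
    and conj: "conjugate_connections A g N N'"
  shows "conjugate_connections A (associated_metric J g) N N' \<longleftrightarrow> parallel_endo A N' J"
proof -
  let ?V = "vector_fields A" and ?D = "covariant_derivative_endo N' J"
  have N'_closed: "N' X Y \<in> ?V" if "X \<in> ?V" "Y \<in> ?V" for X Y
    using N' that by (simp add: linear_connection_def)
  have D_closed: "?D X Z \<in> ?V" if "X \<in> ?V" "Z \<in> ?V" for X Z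
    using that by (simp add: covariant_derivative_endo_def diff_closed N'_closed J_closed)
  have conj_iff: "X (g Y (J Z)) = g (N X Y) (J Z) + g Y (J (N' X Z)) \<longleftrightarrow> g Y (?D X Z) = 0"
    if "X \<in> ?V" "Y \<in> ?V" "Z \<in> ?V" for X Y Z
  proof -
    have "X (g Y (J Z)) = g (N X Y) (J Z) + g Y (N' X (J Z))"
      using conj that J_closed unfolding conjugate_connections_def by blast
    moreover have "g Y (?D X Z) = g Y (N' X (J Z)) - g Y (J (N' X Z))"
      using that by (simp add: covariant_derivative_endo_def diff_right N'_closed J_closed)
    ultimately show ?thesis by simp
  qed
  have D_eq_0_iff: "(\<forall>Y\<in>?V. g Y (?D X Z) = 0) \<longleftrightarrow> ?D X Z = 0"
    if "X \<in> ?V" "Z \<in> ?V" for X Z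
    using nondegenerate[OF D_closed[OF that]] zero_right by auto
  have "conjugate_connections A (associated_metric J g) N N'
      \<longleftrightarrow> (\<forall>X\<in>?V. \<forall>Y\<in>?V. \<forall>Z\<in>?V. g Y (?D X Z) = 0)"
    unfolding conjugate_connections_def associated_metric_def by (intro ball_cong refl conj_iff)
  \<comment> \<open>With \<open>Y\<close> innermost, nondegeneracy applies for each fixed
    \<open>X\<close> and \<open>Z\<close>.\<close>
  also have "\<dots> \<longleftrightarrow> (\<forall>X\<in>?V. \<forall>Z\<in>?V. \<forall>Y\<in>?V. g Y (?D X Z) = 0)"
    by blast
  also have "\<dots> \<longleftrightarrow> parallel_endo A N' J"
    unfolding parallel_endo_def by (intro ball_cong refl D_eq_0_iff)
  finally show ?thesis .
qed

lemma conjugate_associated_iff_parallel: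
  assumes N: "linear_connection A N" and N': "linear_connection A N'"
    and conj: "conjugate_connections A g N N'"
  shows "conjugate_connections A (associated_metric J g) N N' \<longleftrightarrow> parallel_endo A N J"
proof -
  interpret assoc: almost_norden A J "associated_metric J g"
    by unfold_locales (rule associated_norden)
  show ?thesis
    \<comment> \<open>The previous equivalence is applied to the pair \<open>N'\<close>,
      \<open>N\<close>; \<open>assoc.conjugate_swap\<close> restores the order for the associated
      metric.\<close>
    using conjugate_associated_iff_parallel'[OF N' N conjugate_swap[OF N N' conj]]
      assoc.conjugate_swap N N' by blast
qed

text \<open>The twice associated metric is \<open>- g\<close>, and negating the metric changes the
  sign of both sides of the conjugacy identity.\<close>

lemma conjugate_associated_associated:
  assumes N: "linear_connection A N" and N': "linear_connection A N'"
  shows "conjugate_connections A (associated_metric J (associated_metric J g)) N N'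
    \<longleftrightarrow> conjugate_connections A g N N'"
proof -
  let ?g = "associated_metric J (associated_metric J g)"
  have closed: "N X Y \<in> vector_fields A" "N' X Y \<in> vector_fields A"
    if "X \<in> vector_fields A" "Y \<in> vector_fields A" for X Y
    using N N' that by (simp_all add: linear_connection_def)
  show ?thesis
    unfolding conjugate_connections_def
  proof (intro ball_cong refl)
    fix X Y Z assume XYZ: "X \<in> vector_fields A" "Y \<in> vector_fields A" "Z \<in> vector_fields A"
    have "X (?g Y Z) = - X (g Y Z)"
      using XYZ by (simp only: associated_associated vector_field_uminus smooth)
    moreover have "?g (N X Y) Z + ?g Y (N' X Z) = - (g (N X Y) Z + g Y (N' X Z))"
      using XYZ by (simp only: associated_associated closed minus_add_distrib)
    ultimately show "X (?g Y Z) = ?g (N X Y) Z + ?g Y (N' X Z) \<longleftrightarrow>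
        X (g Y Z) = g (N X Y) Z + g Y (N' X Z)"
      by (simp only: neg_equal_iff_equal)
  qed
qed

end

theorem proposition2p1:
  fixes A :: "('m::{t2_space, second_countable_topology}, 'e::euclidean_space) chart set"
    and J :: "'m vfield \<Rightarrow> 'm vfield"
    and g :: "'m vfield \<Rightarrow> 'm vfield \<Rightarrow> 'm \<Rightarrow> real"
    and N N' :: "'m vfield \<Rightarrow> 'm vfield \<Rightarrow> 'm vfield"
  assumes "almost_norden_manifold A J g"
    and "linear_connection A N"
    and "linear_connection A N'"
  shows "(conjugate_connections A g N N' \<and> conjugate_connections A (associated_metric J g) N N'
            \<longrightarrow> parallel_endo A N J \<and> parallel_endo A N' J) \<and>
         (conjugate_connections A g N N' \<and> (parallel_endo A N J \<or> parallel_endo A N' J)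
            \<longrightarrow> conjugate_connections A (associated_metric J g) N N') \<and>
         (conjugate_connections A (associated_metric J g) N N' \<and>
            (parallel_endo A N J \<or> parallel_endo A N' J)
            \<longrightarrow> conjugate_connections A g N N') \<and>
         (conjugate_connections A g N N' \<or> conjugate_connections A (associated_metric J g) N N'
            \<longrightarrow> (parallel_endo A N J \<longleftrightarrow> parallel_endo A N' J))"
proof -
  interpret almost_norden A J g
    using assms(1) by unfold_locales
  interpret assoc: almost_norden A J "associated_metric J g"
    by unfold_locales (rule associated_norden)
  show ?thesis
    \<comment> \<open>The first two facts cover conjugacy relative to \<open>g\<close>. The next two
      start from the associated metric and speak of the twice associated one, which the last fact
      trades for \<open>g\<close>; the rest is propositional.\<close>
    using conjugate_associated_iff_parallel[OF assms(2,3)]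
      conjugate_associated_iff_parallel'[OF assms(2,3)]
      assoc.conjugate_associated_iff_parallel[OF assms(2,3)]
      assoc.conjugate_associated_iff_parallel'[OF assms(2,3)]
      conjugate_associated_associated[OF assms(2,3)]
    by metis
qed

end
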